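(* Let $t\ge 2$ be an integer. For every poset $P$ with finite cardinality $n$, $\operatorname{ldim}_t(P)\ge \log_t n$.
   Context: All posets are nonempty. For an integer $t\ge2$, $\mathbf{t}$ denotes the $t$-element chain. A partial function $f$ from a poset $P$ to a chain is monotone if $x\le y$ with $x,y\in\operatorname{dom}(f)$ implies $f(x)\le f(y)$. A local $t$-realiser of $P$ is a set $\mathcal{R}$ of monotone partial functions from $P$ to $\mathbf{t}$ such that for all $x,y\in P$ with $x\not\ge y$ there is $f\in\mathcal{R}$ with $x,y\in\operatorname{dom}(f)$ and $f(x)<f(y)$. The multiplicity $\mu_{\mathcal{R}}(x)$ of $x\in P$ is the number of $f\in\mathcal{R}$ with $x\in\operatorname{dom}(f)$. The local $t$-dimension $\operatorname{ldim}_t(P)$ is the minimum over all local $t$-realisers $\mathcal{R}$ of $P$ of $\max\{\mu_{\mathcal{R}}(x): x\in P\}$. *)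

theory Defs
  imports Complex_Main
begin

text \<open>
  A poset is a carrier set \<open>A\<close> with a relation \<open>r\<close> such that \<^term>\<open>partial_order_on A r\<close>, where
  \<open>(x, y) \<in> r\<close> means \<open>x \<le> y\<close>. The \<open>t\<close>-element chain is \<^term>\<open>{..<t} :: nat set\<close>.
\<close>

definition monotone_partial_fun :: "nat \<Rightarrow> 'a set \<Rightarrow> 'a rel \<Rightarrow> ('a \<rightharpoonup> nat) \<Rightarrow> bool" where
  "monotone_partial_fun t A r f \<longleftrightarrow>
     dom f \<subseteq> A \<and> ran f \<subseteq> {..<t} \<and>
     (\<forall>x\<in>dom f. \<forall>y\<in>dom f. (x, y) \<in> r \<longrightarrow> the (f x) \<le> the (f y))"

definition local_realiser :: "nat \<Rightarrow> 'a set \<Rightarrow> 'a rel \<Rightarrow> ('a \<rightharpoonup> nat) set \<Rightarrow> bool" where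
  "local_realiser t A r R \<longleftrightarrow>
     (\<forall>f\<in>R. monotone_partial_fun t A r f) \<and>
     (\<forall>x\<in>A. \<forall>y\<in>A. (y, x) \<notin> r \<longrightarrow>
        (\<exists>f\<in>R. x \<in> dom f \<and> y \<in> dom f \<and> the (f x) < the (f y)))"

definition realiser_mult :: "('a \<rightharpoonup> nat) set \<Rightarrow> 'a \<Rightarrow> nat" where
  "realiser_mult R x = card {f \<in> R. x \<in> dom f}"

text \<open>
  Only meaningful for finite nonempty \<open>A\<close>: then every local realiser is finite, and the minimum
  is attained when \<open>t \<ge> 2\<close> (see \<open>ldim_attained\<close>).
\<close>

definition ldim :: "nat \<Rightarrow> 'a set \<Rightarrow> 'a rel \<Rightarrow> nat" where
  "ldim t A r = (LEAST d. \<exists>R. local_realiser t A r R \<and> d = Max (realiser_mult R ` A))"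

lemma finite_local_realiser:
  assumes "finite A" and "local_realiser t A r R"
  shows "finite R"
proof -
  have "R \<subseteq> (\<Union>D\<in>Pow A. {f. dom f = D \<and> ran f \<subseteq> {..<t}})"
    using assms(2) by (auto simp: local_realiser_def monotone_partial_fun_def)
  moreover have "finite (\<Union>D\<in>Pow A. {f. dom f = D \<and> ran f \<subseteq> {..<t}})"
    using assms(1) by (auto intro!: finite_set_of_finite_maps intro: finite_subset)
  ultimately show ?thesis
    by (rule finite_subset)
qed

lemma local_realiser_exists:
  assumes "2 \<le> t" and "partial_order_on A r"
  shows "\<exists>R. local_realiser t A r R"
proof
  let ?R = "{[x \<mapsto> 0, y \<mapsto> Suc 0] | x y. x \<in> A \<and> y \<in> A \<and> (y, x) \<notin> r}"
  have neq: "x \<noteq> y" if "x \<in> A" "(y, x) \<notin> r" for x y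
    using assms(2) that by (auto simp: partial_order_on_def preorder_on_def refl_on_def)
  have "monotone_partial_fun t A r [x \<mapsto> 0, y \<mapsto> Suc 0]"
    if "x \<in> A" "y \<in> A" "(y, x) \<notin> r" for x y
    using that assms(1) by (auto simp: monotone_partial_fun_def ran_def fun_upd_def split: if_splits)
  then have "\<forall>f\<in>?R. monotone_partial_fun t A r f"
    by blast
  moreover have "\<exists>f\<in>?R. x \<in> dom f \<and> y \<in> dom f \<and> the (f x) < the (f y)"
    if "x \<in> A" "y \<in> A" "(y, x) \<notin> r" for x y
  proof (rule bexI)
    show "[x \<mapsto> 0, y \<mapsto> Suc 0] \<in> ?R"
      using that by blast
    show "x \<in> dom [x \<mapsto> 0, y \<mapsto> Suc 0] \<and> y \<in> dom [x \<mapsto> 0, y \<mapsto> Suc 0] \<and>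
        the ([x \<mapsto> 0, y \<mapsto> Suc 0] x) < the ([x \<mapsto> 0, y \<mapsto> Suc 0] y)"
      using neq[OF that(1,3)] by simp
  qed
  ultimately show "local_realiser t A r ?R"
    by (simp only: local_realiser_def) simp
qed

lemma ldim_attained:
  assumes "2 \<le> t" and "partial_order_on A r"
  shows "\<exists>R. local_realiser t A r R \<and> ldim t A r = Max (realiser_mult R ` A)"
  unfolding ldim_def by (rule LeastI_ex) (use local_realiser_exists[OF assms] in blast)

end

theory Submission
  imports Defs "HOL-Library.FuncSet"
begin

text \<open>
  Choose for every \<open>f \<in> R\<close> a value \<open>c f \<in> {..<t}\<close> uniformly and independently, and say that \<open>x\<close>
  survives if \<open>c f = f x\<close> for all \<open>f \<in> R\<close> defined at \<open>x\<close>. This happens with probability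
  \<open>t\<close> to the power of minus the multiplicity of \<open>x\<close>. Two distinct elements never survive together,
  since some \<open>f \<in> R\<close> is defined on both and separates them. So these probabilities sum to at
  most 1, which is a Kraft inequality for the multiplicities.
\<close>

definition surviving_choices :: "nat \<Rightarrow> ('a \<rightharpoonup> nat) set \<Rightarrow> 'a \<Rightarrow> (('a \<rightharpoonup> nat) \<Rightarrow> nat) set" where
  "surviving_choices t R x = (\<Pi>\<^sub>E f\<in>R. if x \<in> dom f then {the (f x)} else {..<t})"

text \<open>Each \<open>f\<close> defined at \<open>x\<close> leaves one value for
  \<open>c f\<close>, every other \<open>f\<close> leaves \<open>t\<close>; the power of
  \<open>t\<close> restores the missing factors. The product form avoids division in
  \<open>nat\<close>.\<close>

lemma card_surviving_choices:
  assumes "finite R"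
  shows "card (surviving_choices t R x) * t ^ realiser_mult R x = t ^ card R"
proof -
  let ?D = "{f \<in> R. x \<in> dom f}"
  have "card (surviving_choices t R x) = (\<Prod>f\<in>R. if x \<in> dom f then 1 else t)"
    unfolding surviving_choices_def card_PiE[OF assms] by (rule prod.cong) auto
  moreover have "t ^ realiser_mult R x = (\<Prod>f\<in>R. if x \<in> dom f then t else 1)"
    unfolding realiser_mult_def using assms by (simp add: prod.inter_filter[symmetric])
  ultimately have "card (surviving_choices t R x) * t ^ realiser_mult R x
      = (\<Prod>f\<in>R. (if x \<in> dom f then 1 else t) * (if x \<in> dom f then t else 1))"
    by (simp only: prod.distrib)
  also have "\<dots> = (\<Prod>f\<in>R. t)"
    by (rule prod.cong) auto
  finally show ?thesis
    by simp
qed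

lemma surviving_choices_subset:
  assumes "local_realiser t A r R"
  shows "surviving_choices t R x \<subseteq> R \<rightarrow>\<^sub>E {..<t}"
  unfolding surviving_choices_def
proof (rule PiE_mono)
  fix f assume "f \<in> R"
  then have "ran f \<subseteq> {..<t}"
    using assms by (simp add: local_realiser_def monotone_partial_fun_def)
  then show "(if x \<in> dom f then {the (f x)} else {..<t}) \<subseteq> {..<t}"
    by (auto simp: ran_def)
qed

text \<open>By antisymmetry one of the two comparisons fails, and the realiser then separates the
  pair strictly in one direction.\<close>

lemma local_realiser_separates:
  assumes "antisym r" and "local_realiser t A r R" and "x \<in> A" and "y \<in> A" and "x \<noteq> y"
  obtains f where "f \<in> R" and "x \<in> dom f" and "y \<in> dom f" and "the (f x) \<noteq> the (f y)"
proof -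
  have "(y, x) \<notin> r \<or> (x, y) \<notin> r"
    using assms(1,5) by (auto dest: antisymD)
  then obtain f where "f \<in> R" "x \<in> dom f" "y \<in> dom f" "the (f x) \<noteq> the (f y)"
    using assms(2-4) unfolding local_realiser_def by (metis less_irrefl)
  then show ?thesis
    by (rule that)
qed

lemma surviving_choices_disjoint:
  assumes "antisym r" and "local_realiser t A r R" and "x \<in> A" and "y \<in> A" and "x \<noteq> y"
  shows "surviving_choices t R x \<inter> surviving_choices t R y = {}"
proof -
  obtain f where f: "f \<in> R" "x \<in> dom f" "y \<in> dom f" "the (f x) \<noteq> the (f y)"
    using assms by (rule local_realiser_separates)
  \<comment> \<open>A common survivor \<open>c\<close> would have to take both values of the
    separating \<open>f\<close>.\<close>
  have "c f = the (f z)" if "c \<in> surviving_choices t R z" "z \<in> dom f" for c z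
    using PiE_mem[OF that(1)[unfolded surviving_choices_def] f(1)] that(2) by simp
  with f(2-4) show ?thesis
    by (metis disjoint_iff)
qed

lemma local_realiser_kraft:
  assumes "0 < t" and "antisym r" and "finite A" and R: "local_realiser t A r R"
  shows "(\<Sum>x\<in>A. 1 / real t ^ realiser_mult R x) \<le> 1"
proof -
  have finR: "finite R"
    using assms(3) R by (rule finite_local_realiser)
  \<comment> \<open>This is the sample space; fixing choices to be \<open>undefined\<close> outside
    \<open>R\<close> keeps it finite.\<close>
  have fin: "finite (R \<rightarrow>\<^sub>E {..<t})"
    using finR by (simp add: finite_PiE)
  have "(\<Sum>x\<in>A. card (surviving_choices t R x)) = card (\<Union>x\<in>A. surviving_choices t R x)"
    using assms(3) surviving_choices_disjoint[OF assms(2) R]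
    by (intro card_UN_disjoint[symmetric])
      (auto intro: finite_subset[OF surviving_choices_subset[OF R] fin])
  also have "\<dots> \<le> card (R \<rightarrow>\<^sub>E {..<t})"
    using surviving_choices_subset[OF R] by (intro card_mono[OF fin]) blast
  also have "\<dots> = t ^ card R"
    using finR by (simp add: card_PiE)
  finally have le: "(\<Sum>x\<in>A. real (card (surviving_choices t R x))) \<le> real t ^ card R"
    by (metis of_nat_le_iff of_nat_power of_nat_sum)
  \<comment> \<open>The Kraft weight of \<open>x\<close> is the fraction of all choices for which
    \<open>x\<close> survives.\<close>
  have "1 / real t ^ realiser_mult R x = real (card (surviving_choices t R x)) / real t ^ card R" for x
  proof -
    have "real (card (surviving_choices t R x)) * real t ^ realiser_mult R x = real t ^ card R"
      using card_surviving_choices[OF finR, of t x] by (metis of_nat_mult of_nat_power)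
    then show ?thesis
      using assms(1) by (subst frac_eq_eq) auto
  qed
  then have "(\<Sum>x\<in>A. 1 / real t ^ realiser_mult R x)
      = (\<Sum>x\<in>A. real (card (surviving_choices t R x))) / real t ^ card R"
    by (simp add: sum_divide_distrib)
  also have "\<dots> \<le> 1"
    using le assms(1) by simp
  finally show ?thesis .
qed

theorem theorem1:
  fixes t n :: nat and A :: "'a set" and r :: "'a rel"
  assumes "2 \<le> t"
    and "partial_order_on A r"
    and "A \<noteq> {}"
    and "finite A"
    and "card A = n"
  shows "real (ldim t A r) \<ge> log (real t) (real n)"
proof -
  define d where "d = ldim t A r"
  obtain R where R: "local_realiser t A r R" and d: "d = Max (realiser_mult R ` A)"
    using ldim_attained[OF assms(1,2)] unfolding d_def by blast
  have "antisym r"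
    using assms(2) by (simp add: partial_order_on_def)
  have "real n / real t ^ d = (\<Sum>x\<in>A. 1 / real t ^ d)"
    using assms(5) by simp
  \<comment> \<open>No multiplicity exceeds the maximum \<open>d\<close>, so every Kraft weight is
    at least \<open>1 / real t ^ d\<close>.\<close>
  also have "\<dots> \<le> (\<Sum>x\<in>A. 1 / real t ^ realiser_mult R x)"
    using assms(1,4) by (intro sum_mono divide_left_mono power_increasing) (auto simp: d)
  also have "\<dots> \<le> 1"
    using assms(1) \<open>antisym r\<close> assms(4) R by (intro local_realiser_kraft) auto
  finally have "real n \<le> real t ^ d"
    using assms(1) by simp
  \<comment> \<open>Monotonicity of \<open>log\<close> is applied at \<open>n\<close>, which must be
    positive.\<close>
  moreover have "0 < n"
    using assms(3-5) by (auto simp: card_gt_0_iff)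
  ultimately have "log (real t) (real n) \<le> log (real t) (real t ^ d)"
    using assms(1) by (intro log_mono) auto
  also have "\<dots> = real d"
    using assms(1) by (simp add: log_nat_power)
  finally show ?thesis
    unfolding d_def .
qed

end
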